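(* Let $(P,C)$ be a weakly involutive poset. Then the inclusion map $e:\mathfrak{B}(P)\to\mathfrak{B}_{ex}(P)$ is a $\mathbb{Z}_2$-homotopy equivalence of $\mathbb{Z}_2$-posets.
   Context: A weakly involutive poset is a finite poset $(P,\leq)$ with a function $C:P\to P$ such that $x\leq y\Rightarrow C(y)\leq C(x)$ and $x\leq C(C(x))$ for all $x$. The box poset is $\mathfrak{B}(P)=\{(x,y)\in P\times P\mid x\leq C(y),\ y\leq C(x)\}$ with the componentwise order and action $(x,y)\mapsto(y,x)$. Let $\widehat{P}=P\cup\{\widehat{0}\}$ be $P$ with a new minimum element $\widehat0$ adjoined. The extended box poset is the subposet of $\widehat P\times\widehat P$ (componentwise order) given by $\mathfrak{B}_{ex}(P)=\mathfrak{B}(P)\cup\{(p,\widehat0)\mid p\in P\}\cup\{(\widehat0,q)\mid q\in P\}$, with action $(x,y)\mapsto(y,x)$. A monotone equivariant map of $\mathbb{Z}_2$-posets is a $\mathbb{Z}_2$-homotopy equivalence if the induced map of order complexes (with induced involutions) is an equivariant homotopy equivalence. *)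

theory Defs
  imports "HOL-Analysis.Analysis"
begin

text \<open>A poset is a carrier set together with a relation that is only inspected on the carrier.\<close>

definition finite_poset :: "'a set \<Rightarrow> ('a \<Rightarrow> 'a \<Rightarrow> bool) \<Rightarrow> bool" where
  "finite_poset P le \<longleftrightarrow> finite P \<and> reflp_on P le \<and> transp_on P le \<and> antisymp_on P le"

definition weakly_involutive_poset ::
    "'a set \<Rightarrow> ('a \<Rightarrow> 'a \<Rightarrow> bool) \<Rightarrow> ('a \<Rightarrow> 'a) \<Rightarrow> bool" where
  "weakly_involutive_poset P le C \<longleftrightarrow>
     finite_poset P le \<and> C \<in> P \<rightarrow> P \<and>
     (\<forall>x\<in>P. \<forall>y\<in>P. le x y \<longrightarrow> le (C y) (C x)) \<and>
     (\<forall>x\<in>P. le x (C (C x)))"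

definition box_poset :: "'a set \<Rightarrow> ('a \<Rightarrow> 'a \<Rightarrow> bool) \<Rightarrow> ('a \<Rightarrow> 'a) \<Rightarrow> ('a \<times> 'a) set" where
  "box_poset P le C = {(x, y) \<in> P \<times> P. le x (C y) \<and> le y (C x)}"

definition box_le :: "('a \<Rightarrow> 'a \<Rightarrow> bool) \<Rightarrow> 'a \<times> 'a \<Rightarrow> 'a \<times> 'a \<Rightarrow> bool" where
  "box_le le = rel_prod le le"

text \<open>The poset obtained from \<open>P\<close> by adjoining a new minimum is \<open>insert None (Some ` P)\<close>
  with the order \<open>hat_le le\<close>.\<close>

fun hat_le :: "('a \<Rightarrow> 'a \<Rightarrow> bool) \<Rightarrow> 'a option \<Rightarrow> 'a option \<Rightarrow> bool" where
  "hat_le le None q \<longleftrightarrow> True"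
| "hat_le le (Some x) None \<longleftrightarrow> False"
| "hat_le le (Some x) (Some y) \<longleftrightarrow> le x y"

definition box_incl :: "'a \<times> 'a \<Rightarrow> 'a option \<times> 'a option" where
  "box_incl = map_prod Some Some"

definition ext_box_poset ::
    "'a set \<Rightarrow> ('a \<Rightarrow> 'a \<Rightarrow> bool) \<Rightarrow> ('a \<Rightarrow> 'a) \<Rightarrow> ('a option \<times> 'a option) set" where
  "ext_box_poset P le C =
     box_incl ` box_poset P le C \<union> {(Some p, None) | p. p \<in> P} \<union> {(None, Some q) | q. q \<in> P}"

definition ext_box_le ::
    "('a \<Rightarrow> 'a \<Rightarrow> bool) \<Rightarrow> 'a option \<times> 'a option \<Rightarrow> 'a option \<times> 'a option \<Rightarrow> bool" where
  "ext_box_le le = rel_prod (hat_le le) (hat_le le)"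

definition Z2_poset :: "'a set \<Rightarrow> ('a \<Rightarrow> 'a \<Rightarrow> bool) \<Rightarrow> ('a \<Rightarrow> 'a) \<Rightarrow> bool" where
  "Z2_poset P le \<nu> \<longleftrightarrow>
     finite_poset P le \<and> \<nu> \<in> P \<rightarrow> P \<and> (\<forall>x\<in>P. \<nu> (\<nu> x) = x) \<and>
     (\<forall>x\<in>P. \<forall>y\<in>P. le x y \<longrightarrow> le (\<nu> x) (\<nu> y))"

definition Z2_poset_map ::
    "'a set \<Rightarrow> ('a \<Rightarrow> 'a \<Rightarrow> bool) \<Rightarrow> ('a \<Rightarrow> 'a) \<Rightarrow>
     'b set \<Rightarrow> ('b \<Rightarrow> 'b \<Rightarrow> bool) \<Rightarrow> ('b \<Rightarrow> 'b) \<Rightarrow> ('a \<Rightarrow> 'b) \<Rightarrow> bool" where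
  "Z2_poset_map P leP \<nu> Q leQ \<mu> f \<longleftrightarrow>
     f \<in> P \<rightarrow> Q \<and> (\<forall>x\<in>P. \<forall>y\<in>P. leP x y \<longrightarrow> leQ (f x) (f y)) \<and> (\<forall>x\<in>P. f (\<nu> x) = \<mu> (f x))"

definition order_complex :: "'a set \<Rightarrow> ('a \<Rightarrow> 'a \<Rightarrow> bool) \<Rightarrow> 'a set set" where
  "order_complex P le = {\<sigma>. \<sigma> \<subseteq> P \<and> finite \<sigma> \<and> \<sigma> \<noteq> {} \<and> totalp_on \<sigma> le}"

text \<open>The geometric realization of an abstract simplicial complex by barycentric coordinates.
  The topology on functions is the product topology; on finite complexes, the only ones
  considered here, the induced topology is the usual (weak) topology of the realization.\<close>

definition realization :: "'a set set \<Rightarrow> ('a \<Rightarrow> real) topology" where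
  "realization K = top_of_set
     {t. (\<forall>v. 0 \<le> t v) \<and> {v. t v \<noteq> 0} \<in> K \<and> (\<Sum>v | t v \<noteq> 0. t v) = 1}"

text \<open>The affine extension of a vertex map to the realizations.\<close>

definition realization_map :: "('a \<Rightarrow> 'b) \<Rightarrow> ('a \<Rightarrow> real) \<Rightarrow> 'b \<Rightarrow> real" where
  "realization_map f t w = (\<Sum>v | t v \<noteq> 0 \<and> f v = w. t v)"

definition Z2_map ::
    "'a topology \<Rightarrow> ('a \<Rightarrow> 'a) \<Rightarrow> 'b topology \<Rightarrow> ('b \<Rightarrow> 'b) \<Rightarrow> ('a \<Rightarrow> 'b) \<Rightarrow> bool" where
  "Z2_map X \<nu> Y \<mu> f \<longleftrightarrow> continuous_map X Y f \<and> (\<forall>x\<in>topspace X. f (\<nu> x) = \<mu> (f x))"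

definition Z2_homotopic ::
    "'a topology \<Rightarrow> ('a \<Rightarrow> 'a) \<Rightarrow> 'b topology \<Rightarrow> ('b \<Rightarrow> 'b) \<Rightarrow> ('a \<Rightarrow> 'b) \<Rightarrow> ('a \<Rightarrow> 'b) \<Rightarrow> bool" where
  "Z2_homotopic X \<nu> Y \<mu> f g \<longleftrightarrow> homotopic_with (Z2_map X \<nu> Y \<mu>) X Y f g"

definition Z2_homotopy_equivalence ::
    "'a topology \<Rightarrow> ('a \<Rightarrow> 'a) \<Rightarrow> 'b topology \<Rightarrow> ('b \<Rightarrow> 'b) \<Rightarrow> ('a \<Rightarrow> 'b) \<Rightarrow> bool" where
  "Z2_homotopy_equivalence X \<nu> Y \<mu> f \<longleftrightarrow>
     Z2_map X \<nu> Y \<mu> f \<and>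
     (\<exists>g. Z2_map Y \<mu> X \<nu> g \<and>
          Z2_homotopic X \<nu> X \<nu> (g \<circ> f) id \<and>
          Z2_homotopic Y \<mu> Y \<mu> (f \<circ> g) id)"

definition Z2_poset_homotopy_equivalence ::
    "'a set \<Rightarrow> ('a \<Rightarrow> 'a \<Rightarrow> bool) \<Rightarrow> ('a \<Rightarrow> 'a) \<Rightarrow>
     'b set \<Rightarrow> ('b \<Rightarrow> 'b \<Rightarrow> bool) \<Rightarrow> ('b \<Rightarrow> 'b) \<Rightarrow> ('a \<Rightarrow> 'b) \<Rightarrow> bool" where
  "Z2_poset_homotopy_equivalence P leP \<nu> Q leQ \<mu> f \<longleftrightarrow>
     Z2_poset P leP \<nu> \<and> Z2_poset Q leQ \<mu> \<and> Z2_poset_map P leP \<nu> Q leQ \<mu> f \<and>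
     Z2_homotopy_equivalence
       (realization (order_complex P leP)) (realization_map \<nu>)
       (realization (order_complex Q leQ)) (realization_map \<mu>)
       (realization_map f)"

end

theory Submission imports Defs begin

text \<open>There is in general no monotone retraction of the extended box poset onto the box poset, but
  there is an order-reversing equivariant map \<open>r\<close> from the nonempty chains of the former, ordered by
  inclusion, to the latter: \<open>r c\<close> consists of the least first and the least second coordinate
  occurring in \<open>c\<close>, where a coordinate that never occurs is replaced by \<open>C\<close> of the greatest other
  coordinate. Composing its realization with the passage to the barycentric subdivision gives a
  homotopy inverse of the inclusion \<open>e\<close>. Indeed, \<open>r (e ` c)\<close> is the least element of \<open>c\<close>, which
  yields a straight-line homotopy on one side; on the other side the least element of \<open>c\<close> lies below
  \<open>e (r c)\<close>, and comparable maps of posets are homotopic.\<close>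

subsection \<open>Realizations of finite posets\<close>

lemma topspace_realization:
  "topspace (realization K) =
     {t. (\<forall>v. 0 \<le> t v) \<and> {v. t v \<noteq> 0} \<in> K \<and> (\<Sum>v | t v \<noteq> 0. t v) = 1}"
  by (simp add: realization_def)

lemma sum_support:
  fixes t :: "'a \<Rightarrow> real"
  assumes "finite Q" "{v. t v \<noteq> 0} \<subseteq> Q"
  shows "(\<Sum>v | t v \<noteq> 0. t v) = sum t Q"
  using assms by (intro sum.mono_neutral_left) auto

text \<open>A finite vertex set makes the total weight a fixed sum over \<open>Q\<close>, hence
  linear in \<open>t\<close>, instead of a sum over a varying support. The support is automatically
  finite, and it is nonempty because the weights sum to 1.\<close>

lemma mem_realization_iff:
  assumes "finite Q"
  shows "t \<in> topspace (realization (order_complex Q le)) \<longleftrightarrow>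
    (\<forall>v. 0 \<le> t v) \<and> {v. t v \<noteq> 0} \<subseteq> Q \<and> totalp_on {v. t v \<noteq> 0} le \<and> sum t Q = 1"
    (is "?L \<longleftrightarrow> ?R")
proof
  assume ?L
  then show ?R
    using sum_support[OF assms, of t] by (auto simp: topspace_realization order_complex_def)
next
  assume R: ?R
  then have "{v. t v \<noteq> 0} \<noteq> {}"
    by (metis (mono_tags, lifting) empty_Collect_eq sum.neutral zero_neq_one)
  moreover have "finite {v. t v \<noteq> 0}"
    using R assms finite_subset by blast
  ultimately show ?L
    using R sum_support[OF assms, of t] by (simp add: topspace_realization order_complex_def)
qed

text \<open>The realization is a subspace of a product of real lines, so continuity can be checked
  one coordinate at a time.\<close>

lemma continuous_map_realization_iff:
  "continuous_map X (realization K) f \<longleftrightarrow>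
     (\<forall>v. continuous_map X euclideanreal (\<lambda>x. f x v)) \<and>
     f \<in> topspace X \<rightarrow> topspace (realization K)"
proof -
  have "continuous_map X euclidean f \<longleftrightarrow> (\<forall>v. continuous_map X euclideanreal (\<lambda>x. f x v))"
    unfolding euclidean_product_topology[symmetric] by (simp add: continuous_map_componentwise_UNIV)
  then show ?thesis
    by (simp add: realization_def continuous_map_in_subtopology image_subset_iff_funcset)
qed

text \<open>The fibre of an involution over \<open>w\<close> is the single point
  \<open>\<nu> w\<close>. Thus the action on realizations is a permutation of coordinates and
  commutes with every coordinatewise formula.\<close>

lemma realization_map_involution:
  assumes "\<And>x. \<nu> (\<nu> x) = x"
  shows "realization_map \<nu> t = t \<circ> \<nu>"
proof
  fix w
  have "{v. t v \<noteq> 0 \<and> \<nu> v = w} = (if t (\<nu> w) = 0 then {} else {\<nu> w})"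
    using assms by auto
  then show "realization_map \<nu> t w = (t \<circ> \<nu>) w"
    by (simp add: realization_map_def)
qed

lemma realization_map_eq_sum:
  assumes "finite Q" "{v. t v \<noteq> 0} \<subseteq> Q"
  shows "realization_map f t w = (\<Sum>v | v \<in> Q \<and> f v = w. t v)"
  unfolding realization_map_def using assms by (intro sum.mono_neutral_left) auto

lemma realization_map_neq_0D:
  assumes "realization_map f t w \<noteq> 0"
  shows "\<exists>v. t v \<noteq> 0 \<and> f v = w"
proof (rule ccontr)
  assume "\<not> ?thesis"
  then have "{v. t v \<noteq> 0 \<and> f v = w} = {}"
    by auto
  then have "realization_map f t w = 0"
    unfolding realization_map_def by (simp only: sum.empty)
  with assms show False
    by simp
qed

section \<open>Equivariant affine maps and straight-line homotopies\<close>

lemma totalp_on_image: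
  assumes "totalp_on A le" "\<And>x y. x \<in> A \<Longrightarrow> y \<in> A \<Longrightarrow> le x y \<Longrightarrow> le' (f x) (f y)"
  shows "totalp_on (f ` A) le'"
  using assms by (auto simp: totalp_on_def) metis

text \<open>Monotonicity sends the supporting chain to a chain, and the fibres of \<open>f\<close>
  partition \<open>Q\<close>, so the total weight is preserved. Each coordinate of the image is a
  finite sum of coordinates, hence continuous.\<close>

lemma realization_map_Z2_map:
  assumes Q: "Z2_poset Q le \<nu>" and R: "Z2_poset R le' \<mu>"
    and f: "Z2_poset_map Q le \<nu> R le' \<mu> f"
    and \<nu>: "\<And>x. \<nu> (\<nu> x) = x" and \<mu>: "\<And>x. \<mu> (\<mu> x) = x"
  shows "Z2_map (realization (order_complex Q le)) (realization_map \<nu>)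
           (realization (order_complex R le')) (realization_map \<mu>) (realization_map f)"
proof -
  let ?X = "realization (order_complex Q le)" and ?Y = "realization (order_complex R le')"
  have fin: "finite Q" "finite R"
    using Q R by (auto simp: Z2_poset_def finite_poset_def)
  have fQ: "f \<in> Q \<rightarrow> R" and mono: "\<And>x y. x \<in> Q \<Longrightarrow> y \<in> Q \<Longrightarrow> le x y \<Longrightarrow> le' (f x) (f y)"
    and eq: "\<And>x. x \<in> Q \<Longrightarrow> f (\<nu> x) = \<mu> (f x)"
    using f by (auto simp: Z2_poset_map_def)
  have \<nu>Q: "\<nu> x \<in> Q" if "x \<in> Q" for x
    using Q that by (auto simp: Z2_poset_def)
  have mem: "realization_map f t \<in> topspace ?Y" if t: "t \<in> topspace ?X" for t
  proof -
    have t': "\<And>v. 0 \<le> t v" "{v. t v \<noteq> 0} \<subseteq> Q" "totalp_on {v. t v \<noteq> 0} le" "sum t Q = 1"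
      using t mem_realization_iff[OF fin(1)] by auto
    have eq: "realization_map f t w = (\<Sum>v | v \<in> Q \<and> f v = w. t v)" for w
      using realization_map_eq_sum[OF fin(1) t'(2)] .
    have supp: "{w. realization_map f t w \<noteq> 0} \<subseteq> f ` {v. t v \<noteq> 0}"
      using realization_map_neq_0D by fastforce
    have "totalp_on (f ` {v. t v \<noteq> 0}) le'"
      using t'(2,3) mono by (intro totalp_on_image[OF t'(3)]) auto
    then have tot: "totalp_on {w. realization_map f t w \<noteq> 0} le'"
      using supp totalp_on_subset by blast
    have "f ` Q \<subseteq> R"
      using fQ by auto
    then have "sum (realization_map f t) R = sum t Q"
      unfolding eq using sum.group[OF fin(1) fin(2), of f t] by simp
    moreover have "{w. realization_map f t w \<noteq> 0} \<subseteq> R"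
      using supp t'(2) fQ by auto
    ultimately show ?thesis
      using tot t' by (simp add: mem_realization_iff[OF fin(2)] eq sum_nonneg)
  qed
  have "continuous_map ?X euclideanreal (\<lambda>t. realization_map f t w)" for w
  proof -
    have "continuous_map ?X euclideanreal (\<lambda>t. t v)" for v
      using continuous_map_realization_iff[of ?X "order_complex Q le" "\<lambda>t. t"] by simp
    then have "continuous_map ?X euclideanreal (\<lambda>t. \<Sum>v | v \<in> Q \<and> f v = w. t v)"
      using fin(1) by (intro continuous_map_sum) auto
    then show ?thesis
      by (rule continuous_map_eq)
        (simp add: mem_realization_iff[OF fin(1)] realization_map_eq_sum[OF fin(1)])
  qed
  moreover have "realization_map f (realization_map \<nu> t) = realization_map \<mu> (realization_map f t)"
    if t: "t \<in> topspace ?X" for t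
  proof
    fix w
    have t': "{v. t v \<noteq> 0} \<subseteq> Q"
      using t mem_realization_iff[OF fin(1)] by auto
    then have "{v. (t \<circ> \<nu>) v \<noteq> 0} \<subseteq> Q"
      using \<nu>Q[of "\<nu> v" for v] by (auto simp: \<nu>)
    then have "realization_map f (t \<circ> \<nu>) w = (\<Sum>v | v \<in> Q \<and> f v = w. t (\<nu> v))"
      by (simp add: realization_map_eq_sum[OF fin(1)])
    also have "\<dots> = (\<Sum>v | v \<in> Q \<and> f v = \<mu> w. t v)"
      by (rule sum.reindex_bij_witness[of _ \<nu> \<nu>]) (auto simp: \<nu> \<mu> \<nu>Q eq)
    also have "\<dots> = realization_map f t (\<mu> w)"
      by (simp add: realization_map_eq_sum[OF fin(1) t'])
    finally show "realization_map f (realization_map \<nu> t) w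
        = realization_map \<mu> (realization_map f t) w"
      by (simp add: realization_map_involution \<nu> \<mu>)
  qed
  ultimately show ?thesis
    using mem by (auto simp: Z2_map_def continuous_map_realization_iff)
qed

text \<open>The segment from \<open>f x\<close> to \<open>g x\<close> has its support inside the
  union of the two supports; if this union is a chain, the segment stays within one simplex. The
  action permutes coordinates, so it commutes with convex combinations and every stage is
  equivariant.\<close>

lemma Z2_homotopic_straight_line:
  assumes fin: "finite R" and \<mu>: "\<And>x. \<mu> (\<mu> x) = x"
    and f: "Z2_map X \<nu> (realization (order_complex R le)) (realization_map \<mu>) f"
    and g: "Z2_map X \<nu> (realization (order_complex R le)) (realization_map \<mu>) g"
    and chain: "\<And>x. x \<in> topspace X \<Longrightarrow> totalp_on ({v. f x v \<noteq> 0} \<union> {v. g x v \<noteq> 0}) le"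
  shows "Z2_homotopic X \<nu> (realization (order_complex R le)) (realization_map \<mu>) f g"
proof -
  let ?Y = "realization (order_complex R le)"
  define h where "h = (\<lambda>(s::real, x) v. (1 - s) * f x v + s * g x v)"
  have cf: "continuous_map X euclideanreal (\<lambda>x. f x v)"
    and cg: "continuous_map X euclideanreal (\<lambda>x. g x v)" for v
    using f g by (auto simp: Z2_map_def continuous_map_realization_iff)
  have mem: "h (s, x) \<in> topspace ?Y" if s: "s \<in> {0..1}" and x: "x \<in> topspace X" for s x
  proof -
    have "f x \<in> topspace ?Y" "g x \<in> topspace ?Y"
      using f g x by (auto simp: Z2_map_def continuous_map_realization_iff)
    then have fx: "\<And>v. 0 \<le> f x v" "{v. f x v \<noteq> 0} \<subseteq> R" "sum (f x) R = 1"
      and gx: "\<And>v. 0 \<le> g x v" "{v. g x v \<noteq> 0} \<subseteq> R" "sum (g x) R = 1"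
      by (auto simp: mem_realization_iff[OF fin])
    have supp: "{v. h (s, x) v \<noteq> 0} \<subseteq> {v. f x v \<noteq> 0} \<union> {v. g x v \<noteq> 0}"
      by (auto simp: h_def)
    then have "totalp_on {v. h (s, x) v \<noteq> 0} le"
      using chain[OF x] totalp_on_subset by blast
    moreover have "sum (h (s, x)) R = 1"
      using fx(3) gx(3) by (simp add: h_def sum.distrib flip: sum_distrib_left)
    moreover have "0 \<le> h (s, x) v" for v
      using s fx(1) gx(1) by (simp add: h_def)
    ultimately show ?thesis
      using supp fx(2) gx(2) unfolding mem_realization_iff[OF fin] by blast
  qed
  let ?I = "prod_topology (top_of_set {0..1::real}) X"
  have "continuous_map ?I euclideanreal fst"
    using continuous_map_into_fulltopology[OF continuous_map_fst] .
  moreover have "continuous_map ?I euclideanreal (\<lambda>p. f (snd p) v)"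
    and "continuous_map ?I euclideanreal (\<lambda>p. g (snd p) v)" for v
    using continuous_map_compose[OF continuous_map_snd cf]
      continuous_map_compose[OF continuous_map_snd cg] by (simp_all add: o_def)
  ultimately have "continuous_map ?I euclideanreal (\<lambda>p. h p v)" for v
    unfolding h_def case_prod_unfold
    by (intro continuous_map_add continuous_map_real_mult continuous_map_diff) auto
  then have cont: "continuous_map ?I ?Y h"
    unfolding continuous_map_realization_iff using mem by auto
  have "Z2_map X \<nu> ?Y (realization_map \<mu>) (\<lambda>x. h (s, x))" if s: "s \<in> {0..1}" for s
  proof -
    have "continuous_map X ?I (\<lambda>x. (s, x))"
      using s by (auto simp: continuous_map_pairwise o_def)
    from continuous_map_compose[OF this cont] have "continuous_map X ?Y (\<lambda>x. h (s, x))"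
      by (simp add: o_def)
    moreover have "h (s, \<nu> x) = realization_map \<mu> (h (s, x))" if "x \<in> topspace X" for x
      using f g that by (auto simp: Z2_map_def h_def realization_map_involution \<mu> fun_eq_iff)
    ultimately show ?thesis
      by (simp add: Z2_map_def)
  qed
  then show ?thesis
    unfolding Z2_homotopic_def homotopic_with_def
    using cont by (intro exI[of _ h]) (auto simp: h_def)
qed

subsection \<open>Maps defined on chains\<close>

text \<open>On the realization of a poset, the chains of nonzero weight are superlevel sets of \<open>t\<close>. They
  are therefore nested, and the normalized weights are coordinates in the barycentric subdivision.
  These are not the usual coordinates, but they are visibly continuous.\<close>

definition sd_weight :: "'a set \<Rightarrow> ('a \<Rightarrow> real) \<Rightarrow> 'a set \<Rightarrow> real" where
  "sd_weight Q t c = (\<Prod>v\<in>c. t v * (\<Prod>u\<in>Q - c. max 0 (t v - t u)))"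

text \<open>Subdivision followed by the affine extension of \<open>\<phi>\<close>, in a single
  formula: the normalized weight of each chain is placed at its value under \<open>\<phi>\<close>.
  No realization with chains as vertices has to be formed.\<close>

definition sd_map ::
    "'a set \<Rightarrow> ('a \<Rightarrow> 'a \<Rightarrow> bool) \<Rightarrow> ('a set \<Rightarrow> 'b) \<Rightarrow> ('a \<Rightarrow> real) \<Rightarrow> 'b \<Rightarrow> real" where
  "sd_map Q le \<phi> t z =
     (\<Sum>c | c \<in> order_complex Q le \<and> \<phi> c = z. sd_weight Q t c) /
     (\<Sum>c\<in>order_complex Q le. sd_weight Q t c)"

text \<open>These are the equivariant order-reversing maps out of the face poset of the order
  complex. Reversal is harmless, since a poset and its opposite have the same chains, and it fits
  maps built from least elements, which drop as a chain grows.\<close>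

definition antitone_chain_map ::
    "'a set \<Rightarrow> ('a \<Rightarrow> 'a \<Rightarrow> bool) \<Rightarrow> ('a \<Rightarrow> 'a) \<Rightarrow>
     'b set \<Rightarrow> ('b \<Rightarrow> 'b \<Rightarrow> bool) \<Rightarrow> ('b \<Rightarrow> 'b) \<Rightarrow> ('a set \<Rightarrow> 'b) \<Rightarrow> bool" where
  "antitone_chain_map Q le \<nu> R le' \<mu> \<phi> \<longleftrightarrow>
     \<phi> \<in> order_complex Q le \<rightarrow> R \<and>
     (\<forall>c\<in>order_complex Q le. \<forall>d\<in>order_complex Q le. c \<subseteq> d \<longrightarrow> le' (\<phi> d) (\<phi> c)) \<and>
     (\<forall>c\<in>order_complex Q le. \<phi> (\<nu> ` c) = \<mu> (\<phi> c))"

section \<open>Nestedness and positivity of the chain weights\<close>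

lemma finite_order_complex: "finite Q \<Longrightarrow> finite (order_complex Q le)"
  by (rule finite_subset[of _ "Pow Q"]) (auto simp: order_complex_def)

lemma sd_weight_nonneg: "(\<And>v. 0 \<le> t v) \<Longrightarrow> 0 \<le> sd_weight Q t c"
  unfolding sd_weight_def by (intro prod_nonneg ballI mult_nonneg_nonneg) auto

lemma sd_weight_neq_0D:
  assumes "finite Q" "c \<subseteq> Q" "sd_weight Q t c \<noteq> 0"
  shows "v \<in> c \<Longrightarrow> t v \<noteq> 0" and "v \<in> c \<Longrightarrow> u \<in> Q - c \<Longrightarrow> t u < t v"
proof -
  have "finite c" "finite (Q - c)"
    using assms finite_subset by auto
  with assms(3) have "t v \<noteq> 0 \<and> (\<forall>u\<in>Q - c. max 0 (t v - t u) \<noteq> 0)" if "v \<in> c" for v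
    using that by (simp add: sd_weight_def)
  then show "v \<in> c \<Longrightarrow> t v \<noteq> 0" and "v \<in> c \<Longrightarrow> u \<in> Q - c \<Longrightarrow> t u < t v"
    by (blast, smt (verit))
qed

text \<open>Points \<open>u\<close> in \<open>c\<close> but not in \<open>d\<close> and
  \<open>v\<close> in \<open>d\<close> but not in \<open>c\<close> would need both
  \<open>t v < t u\<close> and \<open>t u < t v\<close>.\<close>

lemma sd_weight_nested:
  assumes "finite Q" "c \<subseteq> Q" "d \<subseteq> Q" "sd_weight Q t c \<noteq> 0" "sd_weight Q t d \<noteq> 0"
  shows "c \<subseteq> d \<or> d \<subseteq> c"
proof (rule ccontr)
  assume "\<not> ?thesis"
  then obtain u v where "u \<in> c" "u \<notin> d" "v \<in> d" "v \<notin> c"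
    by blast
  with assms sd_weight_neq_0D(2)[of Q c t u v] sd_weight_neq_0D(2)[of Q d t v u] show False
    by fastforce
qed

text \<open>This makes the denominator of \<open>sd_map\<close> nonzero. The vertices at which
  \<open>t\<close> attains its maximum form a chain of positive weight, and no other chain
  contributes negatively.\<close>

lemma sd_weight_sum_pos:
  assumes fin: "finite Q" and t: "t \<in> topspace (realization (order_complex Q le))"
  shows "0 < (\<Sum>c\<in>order_complex Q le. sd_weight Q t c)"
proof -
  have t': "\<And>v. 0 \<le> t v" "{v. t v \<noteq> 0} \<subseteq> Q" "totalp_on {v. t v \<noteq> 0} le" "sum t Q = 1"
    using t mem_realization_iff[OF fin] by auto
  define c where "c = {v \<in> Q. t v = Max (t ` Q)}"
  have "Q \<noteq> {}"
    using t'(4) by auto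
  then have "Max (t ` Q) \<in> t ` Q"
    using fin by (intro Max_in) auto
  then have "c \<noteq> {}"
    by (auto simp: c_def)
  have le_Max: "t v \<le> Max (t ` Q)" if "v \<in> Q" for v
    using fin that by simp
  have pos: "0 < Max (t ` Q)"
  proof (rule ccontr)
    assume "\<not> 0 < Max (t ` Q)"
    then have "sum t Q \<le> 0"
      by (intro sum_nonpos) (use le_Max in force)
    with t'(4) show False
      by simp
  qed
  have "c \<subseteq> {v. t v \<noteq> 0}"
    using pos by (auto simp: c_def)
  then have "totalp_on c le"
    using t'(3) totalp_on_subset by blast
  then have c: "c \<in> order_complex Q le"
    using fin \<open>c \<noteq> {}\<close> by (auto simp: order_complex_def c_def)
  have "t u < t v" if "v \<in> c" "u \<in> Q - c" for u v
    using that le_Max[of u] by (auto simp: c_def)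
  then have "0 < sd_weight Q t c"
    unfolding sd_weight_def using pos by (intro prod_pos ballI mult_pos_pos) (auto simp: c_def)
  then show ?thesis
    using c fin t'(1) by (intro sum_pos2[of _ c]) (auto simp: finite_order_complex sd_weight_nonneg)
qed

lemma sd_map_neq_0D:
  assumes "sd_map Q le \<phi> t z \<noteq> 0"
  shows "\<exists>c\<in>order_complex Q le. sd_weight Q t c \<noteq> 0 \<and> \<phi> c = z"
proof (rule ccontr)
  assume "\<not> ?thesis"
  then have "(\<Sum>c | c \<in> order_complex Q le \<and> \<phi> c = z. sd_weight Q t c) = 0"
    by (intro sum.neutral) auto
  with assms show False
    by (simp add: sd_map_def)
qed

lemma image_in_order_complex:
  assumes "c \<in> order_complex Q le" "f \<in> Q \<rightarrow> R"
    and "\<And>x y. x \<in> Q \<Longrightarrow> y \<in> Q \<Longrightarrow> le x y \<Longrightarrow> le' (f x) (f y)"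
  shows "f ` c \<in> order_complex R le'"
proof -
  have "totalp_on (f ` c) le'"
    using assms by (intro totalp_on_image[where le = le]) (auto simp: order_complex_def)
  then show ?thesis
    using assms by (auto simp: order_complex_def)
qed

text \<open>Chains of nonzero weight are nested, so their values under the antitone
  \<open>\<phi>\<close> are pairwise comparable and support a simplex. Equivariance comes from
  reindexing both sums along the action of \<open>\<nu>\<close> on chains.\<close>

lemma sd_map_Z2_map:
  assumes Q: "Z2_poset Q le \<nu>" and R: "Z2_poset R le' \<mu>"
    and \<phi>: "antitone_chain_map Q le \<nu> R le' \<mu> \<phi>"
    and \<nu>: "\<And>x. \<nu> (\<nu> x) = x" and \<mu>: "\<And>x. \<mu> (\<mu> x) = x"
  shows "Z2_map (realization (order_complex Q le)) (realization_map \<nu>)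
           (realization (order_complex R le')) (realization_map \<mu>) (sd_map Q le \<phi>)"
proof -
  let ?K = "order_complex Q le"
  let ?X = "realization ?K" and ?Y = "realization (order_complex R le')"
  have fin: "finite Q" "finite R" and \<nu>Q: "\<nu> \<in> Q \<rightarrow> Q"
    and \<nu>mono: "\<And>x y. x \<in> Q \<Longrightarrow> y \<in> Q \<Longrightarrow> le x y \<Longrightarrow> le (\<nu> x) (\<nu> y)"
    using Q R by (auto simp: Z2_poset_def finite_poset_def)
  note finK = finite_order_complex[OF fin(1), of le]
  have \<phi>R: "\<phi> \<in> ?K \<rightarrow> R" and anti: "\<And>c d. c \<in> ?K \<Longrightarrow> d \<in> ?K \<Longrightarrow> c \<subseteq> d \<Longrightarrow> le' (\<phi> d) (\<phi> c)"
    and eq: "\<And>c. c \<in> ?K \<Longrightarrow> \<phi> (\<nu> ` c) = \<mu> (\<phi> c)"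
    using \<phi> by (auto simp: antitone_chain_map_def)
  have KQ: "c \<subseteq> Q" if "c \<in> ?K" for c
    using that by (auto simp: order_complex_def)
  have \<nu>\<nu>: "\<nu> ` \<nu> ` c = c" for c
    by (simp add: image_image \<nu>)
  have \<nu>K: "\<nu> ` c \<in> ?K" if "c \<in> ?K" for c
    using image_in_order_complex[OF that \<nu>Q] \<nu>mono by blast
  have mem: "sd_map Q le \<phi> t \<in> topspace ?Y" if t: "t \<in> topspace ?X" for t
  proof -
    have t': "\<And>v. 0 \<le> t v"
      using t mem_realization_iff[OF fin(1)] by auto
    have supp: "\<exists>c\<in>?K. sd_weight Q t c \<noteq> 0 \<and> \<phi> c = z" if "sd_map Q le \<phi> t z \<noteq> 0" for z
      using sd_map_neq_0D[OF that] .
    have "totalp_on {z. sd_map Q le \<phi> t z \<noteq> 0} le'"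
    proof (rule totalp_onI)
      fix x y
      assume "x \<in> {z. sd_map Q le \<phi> t z \<noteq> 0}" "y \<in> {z. sd_map Q le \<phi> t z \<noteq> 0}"
      then obtain c d where c: "c \<in> ?K" "sd_weight Q t c \<noteq> 0" "\<phi> c = x"
        and d: "d \<in> ?K" "sd_weight Q t d \<noteq> 0" "\<phi> d = y"
        using supp by blast
      have "c \<subseteq> d \<or> d \<subseteq> c"
        using sd_weight_nested fin(1) KQ c d by metis
      then show "le' x y \<or> le' y x"
        using anti c d by blast
    qed
    moreover have "sum (sd_map Q le \<phi> t) R = 1"
    proof -
      have "\<phi> ` ?K \<subseteq> R"
        using \<phi>R by auto
      then have "(\<Sum>z\<in>R. \<Sum>c | c \<in> ?K \<and> \<phi> c = z. sd_weight Q t c) = (\<Sum>c\<in>?K. sd_weight Q t c)"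
        using sum.group[OF finK fin(2)] by blast
      then show ?thesis
        unfolding sd_map_def sum_divide_distrib[symmetric]
        using sd_weight_sum_pos[OF fin(1) t] by simp
    qed
    moreover have "0 \<le> sd_map Q le \<phi> t z" for z
      unfolding sd_map_def using t' by (intro divide_nonneg_nonneg sum_nonneg sd_weight_nonneg)
    moreover have "{z. sd_map Q le \<phi> t z \<noteq> 0} \<subseteq> R"
      using supp \<phi>R by auto
    ultimately show ?thesis
      by (simp add: mem_realization_iff[OF fin(2)])
  qed
  have coord: "continuous_map ?X euclideanreal (\<lambda>t. t v)" for v
    using continuous_map_realization_iff[of ?X ?K "\<lambda>t. t"] by simp
  have "continuous_map ?X euclideanreal (\<lambda>t. sd_weight Q t c)" if "c \<in> ?K" for c
    unfolding sd_weight_def using coord KQ[OF that] fin(1) finite_subset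
    by (intro continuous_map_prod continuous_map_real_mult continuous_map_real_max
        continuous_map_diff) auto
  then have cont: "continuous_map ?X euclideanreal (\<lambda>t. sd_map Q le \<phi> t z)" for z
    unfolding sd_map_def using finK sd_weight_sum_pos[OF fin(1), of _ le]
    by (intro continuous_map_real_divide continuous_map_sum) force+
  have weight: "sd_weight Q t (\<nu> ` c) = sd_weight Q (t \<circ> \<nu>) c" for t c
  proof -
    have inj: "inj_on \<nu> A" for A
      using \<nu> by (metis inj_onI)
    \<comment> \<open>The weight of \<open>c\<close> also involves the complement of
      \<open>c\<close> in \<open>Q\<close>, so \<open>\<nu>\<close> has to permute \<open>Q\<close>,
      not merely map it into itself.\<close>
    have "\<nu> ` Q = Q"
      using \<nu>Q \<nu>\<nu>[of Q] by blast
    then have "Q - \<nu> ` c = \<nu> ` (Q - c)"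
      using image_set_diff[of \<nu> Q c] inj[of UNIV] by simp
    then show ?thesis
      by (simp add: sd_weight_def prod.reindex[OF inj] \<nu> o_def)
  qed
  have "sd_map Q le \<phi> (realization_map \<nu> t) = realization_map \<mu> (sd_map Q le \<phi> t)" for t
  proof
    fix z
    have "(\<Sum>c | c \<in> ?K \<and> \<phi> c = z. sd_weight Q (t \<circ> \<nu>) c)
        = (\<Sum>c | c \<in> ?K \<and> \<phi> c = \<mu> z. sd_weight Q t c)"
      by (rule sum.reindex_bij_witness[of _ "image \<nu>" "image \<nu>"])
        (auto simp: \<nu>\<nu> \<nu>K eq \<mu> weight)
    moreover have "(\<Sum>c\<in>?K. sd_weight Q (t \<circ> \<nu>) c) = (\<Sum>c\<in>?K. sd_weight Q t c)"
      by (rule sum.reindex_bij_witness[of _ "image \<nu>" "image \<nu>"])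
        (simp_all add: \<nu>\<nu> \<nu>K weight)
    ultimately show "sd_map Q le \<phi> (realization_map \<nu> t) z = realization_map \<mu> (sd_map Q le \<phi> t) z"
      by (simp add: sd_map_def realization_map_involution \<nu> \<mu>)
  qed
  then show ?thesis
    using mem cont by (auto simp: Z2_map_def continuous_map_realization_iff)
qed

text \<open>Members of \<open>S\<close> are nested, so only pairs with
  \<open>c \<subseteq> d\<close> matter. Two values of the same map are compared by
  \<open>anti\<close>; \<open>comp\<close> treats both mixed pairs because either map may be
  evaluated at the smaller chain.\<close>

lemma sd_weight_totalp_on:
  assumes fin: "finite Q"
    and comp: "\<And>c d. c \<in> order_complex Q le \<Longrightarrow> d \<in> order_complex Q le \<Longrightarrow> c \<subseteq> d \<Longrightarrow>
      (le' (\<phi> c) (\<psi> d) \<or> le' (\<psi> d) (\<phi> c)) \<and> (le' (\<phi> d) (\<psi> c) \<or> le' (\<psi> c) (\<phi> d))"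
    and anti: "\<And>c d. c \<in> order_complex Q le \<Longrightarrow> d \<in> order_complex Q le \<Longrightarrow> c \<subseteq> d \<Longrightarrow>
      le' (\<phi> d) (\<phi> c) \<and> le' (\<psi> d) (\<psi> c)"
    and S: "S = {c \<in> order_complex Q le. sd_weight Q t c \<noteq> 0}"
  shows "totalp_on (\<phi> ` S \<union> \<psi> ` S) le'"
proof -
  have nested: "c \<subseteq> d \<or> d \<subseteq> c" and K: "c \<in> order_complex Q le"
    if "c \<in> S" "d \<in> S" for c d
    using that fin sd_weight_nested[of Q c d t] by (auto simp: S order_complex_def)
  show ?thesis
    by (rule totalp_onI) (use nested K comp anti in \<open>(elim UnE imageE; metis)\<close>)
qed

lemma sd_map_support:
  "{z. sd_map Q le \<phi> t z \<noteq> 0} \<subseteq> \<phi> ` {c \<in> order_complex Q le. sd_weight Q t c \<noteq> 0}"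
  by (auto dest!: sd_map_neq_0D)

text \<open>At each point both supports lie among the values of \<open>\<phi>\<close> and
  \<open>\<psi>\<close> on the chains of nonzero weight. By \<open>comp\<close> these values form
  one chain, so a straight line joins the two maps.\<close>

lemma sd_map_homotopic_comparable:
  assumes Q: "Z2_poset Q le \<nu>" and R: "Z2_poset R le' \<mu>"
    and \<phi>: "antitone_chain_map Q le \<nu> R le' \<mu> \<phi>" and \<psi>: "antitone_chain_map Q le \<nu> R le' \<mu> \<psi>"
    and \<nu>: "\<And>x. \<nu> (\<nu> x) = x" and \<mu>: "\<And>x. \<mu> (\<mu> x) = x"
    and comp: "\<And>c d. c \<in> order_complex Q le \<Longrightarrow> d \<in> order_complex Q le \<Longrightarrow> c \<subseteq> d \<Longrightarrow>
      (le' (\<phi> c) (\<psi> d) \<or> le' (\<psi> d) (\<phi> c)) \<and> (le' (\<phi> d) (\<psi> c) \<or> le' (\<psi> c) (\<phi> d))"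
  shows "Z2_homotopic (realization (order_complex Q le)) (realization_map \<nu>)
           (realization (order_complex R le')) (realization_map \<mu>) (sd_map Q le \<phi>) (sd_map Q le \<psi>)"
proof (rule Z2_homotopic_straight_line)
  show "finite R"
    using R by (simp add: Z2_poset_def finite_poset_def)
  fix t
  have "finite Q"
    using Q by (simp add: Z2_poset_def finite_poset_def)
  moreover have "le' (\<phi> d) (\<phi> c) \<and> le' (\<psi> d) (\<psi> c)"
    if "c \<in> order_complex Q le" "d \<in> order_complex Q le" "c \<subseteq> d" for c d
    using \<phi> \<psi> that by (simp add: antitone_chain_map_def)
  ultimately have "totalp_on (\<phi> ` {c \<in> order_complex Q le. sd_weight Q t c \<noteq> 0} \<union>
      \<psi> ` {c \<in> order_complex Q le. sd_weight Q t c \<noteq> 0}) le'"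
    using comp by (intro sd_weight_totalp_on[OF _ _ _ refl]) auto
  then show "totalp_on ({z. sd_map Q le \<phi> t z \<noteq> 0} \<union> {z. sd_map Q le \<psi> t z \<noteq> 0}) le'"
    by (rule totalp_on_subset) (intro Un_mono sd_map_support)
qed (use sd_map_Z2_map[OF Q R _ \<nu> \<mu>] \<phi> \<psi> \<mu> in auto)

text \<open>A chain of chains has at most one member of each cardinality, so switching from
  \<open>\<phi>\<close> to \<open>\<psi>\<close> one cardinality at a time keeps all images in a common chain.\<close>

lemma sd_map_homotopic_le:
  assumes Q: "Z2_poset Q le \<nu>" and R: "Z2_poset R le' \<mu>"
    and \<phi>: "antitone_chain_map Q le \<nu> R le' \<mu> \<phi>" and \<psi>: "antitone_chain_map Q le \<nu> R le' \<mu> \<psi>"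
    and \<nu>: "\<And>x. \<nu> (\<nu> x) = x" and \<mu>: "\<And>x. \<mu> (\<mu> x) = x"
    and le: "\<And>c. c \<in> order_complex Q le \<Longrightarrow> le' (\<phi> c) (\<psi> c)"
  shows "Z2_homotopic (realization (order_complex Q le)) (realization_map \<nu>)
           (realization (order_complex R le')) (realization_map \<mu>) (sd_map Q le \<phi>) (sd_map Q le \<psi>)"
proof -
  let ?K = "order_complex Q le"
  have fin: "finite Q" and refl: "\<And>x. x \<in> R \<Longrightarrow> le' x x"
    using Q R by (auto simp: Z2_poset_def finite_poset_def reflp_on_def)
  have trans: "\<And>x y z. x \<in> R \<Longrightarrow> y \<in> R \<Longrightarrow> z \<in> R \<Longrightarrow> le' x y \<Longrightarrow> le' y z \<Longrightarrow> le' x z"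
    using R unfolding Z2_poset_def finite_poset_def transp_on_def by blast
  have \<phi>R: "\<phi> c \<in> R" and \<psi>R: "\<psi> c \<in> R" and \<phi>eq: "\<phi> (\<nu> ` c) = \<mu> (\<phi> c)"
    and \<psi>eq: "\<psi> (\<nu> ` c) = \<mu> (\<psi> c)" if "c \<in> ?K" for c
    using \<phi> \<psi> that by (auto simp: antitone_chain_map_def)
  have \<phi>a: "le' (\<phi> d) (\<phi> c)" and \<psi>a: "le' (\<psi> d) (\<psi> c)"
    if "c \<in> ?K" "d \<in> ?K" "c \<subseteq> d" for c d
    using \<phi> \<psi> that by (auto simp: antitone_chain_map_def)
  have mix: "le' (\<phi> d) (\<psi> c)" if "c \<in> ?K" "d \<in> ?K" "c \<subseteq> d" for c d
    using trans[OF \<phi>R \<phi>R \<psi>R \<phi>a le] that by blast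
  have card_le: "card c \<le> card d" and card_eq: "card c = card d \<Longrightarrow> c = d"
    if "c \<in> ?K" "d \<in> ?K" "c \<subseteq> d" for c d
    using that by (auto simp: order_complex_def card_mono card_subset_eq)
  have card_\<nu>: "card (\<nu> ` c) = card c" for c
    using \<nu> by (intro card_image) (metis inj_onI)
  \<comment> \<open>Small chains must be switched first: values drop as chains grow and
    \<open>\<psi>\<close> is the larger map, so the only mixed comparison needed for antitonicity is
    \<open>\<phi> d\<close> below \<open>\<psi> c\<close> for \<open>c \<subseteq> d\<close>, which
    is \<open>mix\<close>.\<close>
  define hyb where "hyb k c = (if card c < k then \<psi> c else \<phi> c)" for k c
  have hyb: "antitone_chain_map Q le \<nu> R le' \<mu> (hyb k)" for k
    unfolding antitone_chain_map_def hyb_def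
    using \<phi>R \<psi>R \<phi>eq \<psi>eq \<phi>a \<psi>a mix card_le by (fastforce simp: card_\<nu>)
  have "Z2_homotopic (realization ?K) (realization_map \<nu>)
      (realization (order_complex R le')) (realization_map \<mu>) (sd_map Q le \<phi>) (sd_map Q le (hyb k))" for k
  proof (induction k)
    case 0
    have "hyb 0 = \<phi>"
      by (simp add: hyb_def fun_eq_iff)
    then show ?case
      using sd_map_Z2_map[OF Q R \<phi> \<nu> \<mu>] by (simp add: Z2_homotopic_def Z2_map_def)
  next
    case (Suc k)
    have "(le' (hyb k c) (hyb (Suc k) d) \<or> le' (hyb (Suc k) d) (hyb k c)) \<and>
        (le' (hyb k d) (hyb (Suc k) c) \<or> le' (hyb (Suc k) c) (hyb k d))"
      if c: "c \<in> ?K" "d \<in> ?K" "c \<subseteq> d" for c d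
    proof (cases "c = d")
      case True
      then show ?thesis
        using c le refl \<phi>R \<psi>R by (auto simp: hyb_def)
    next
      \<comment> \<open>The uncontrolled pair \<open>\<psi> d\<close>, \<open>\<phi> c\<close> never
        arises: if \<open>d\<close> is already switched at either stage, the strictly smaller
        \<open>c\<close> is switched at both.\<close>
      case False
      then have "card c < card d"
        using card_le[OF c] card_eq[OF c] by linarith
      then show ?thesis
        using \<phi>a[OF c] \<psi>a[OF c] mix[OF c] by (auto simp: hyb_def)
    qed
    then have "Z2_homotopic (realization ?K) (realization_map \<nu>) (realization (order_complex R le'))
        (realization_map \<mu>) (sd_map Q le (hyb k)) (sd_map Q le (hyb (Suc k)))"
      by (rule sd_map_homotopic_comparable[OF Q R hyb hyb \<nu> \<mu>])
    then show ?case
      using Suc.IH homotopic_with_trans unfolding Z2_homotopic_def by blast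
  qed
  \<comment> \<open>A chain may be all of \<open>Q\<close>, and \<open>hyb\<close> tests a strict
    inequality, hence the successor. The hybrid is shown to agree with \<open>\<psi>\<close> on
    chains only, which is all that \<open>sd_map\<close> sees.\<close>
  moreover have "sd_map Q le (hyb (Suc (card Q))) = sd_map Q le \<psi>"
  proof -
    have "hyb (Suc (card Q)) c = \<psi> c" if "c \<in> ?K" for c
      using that card_mono[OF fin, of c] by (auto simp: hyb_def order_complex_def)
    then have "{c \<in> ?K. hyb (Suc (card Q)) c = z} = {c \<in> ?K. \<psi> c = z}" for z
      by auto
    then show ?thesis
      by (simp add: sd_map_def fun_eq_iff)
  qed
  ultimately show ?thesis
    by metis
qed

subsection \<open>Least elements of chains\<close>

text \<open>Taking the relation as a parameter lets the same constant give greatest elements,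
  through \<open>le\<inverse>\<inverse>\<close>.\<close>

definition poset_least :: "('a \<Rightarrow> 'a \<Rightarrow> bool) \<Rightarrow> 'a set \<Rightarrow> 'a" where
  "poset_least le A = (THE x. x \<in> A \<and> (\<forall>y\<in>A. le x y))"

lemma poset_least_eqI:
  assumes "finite_poset P le" "A \<subseteq> P" "x \<in> A" "\<And>y. y \<in> A \<Longrightarrow> le x y"
  shows "poset_least le A = x"
  unfolding poset_least_def
proof (rule the_equality)
  show "z = x" if "z \<in> A \<and> (\<forall>y\<in>A. le z y)" for z
    using that assms unfolding finite_poset_def antisymp_on_def by blast
qed (use assms in auto)

lemma poset_least:
  assumes P: "finite_poset P le" and c: "c \<in> order_complex P le"
  shows "poset_least le c \<in> c" and "y \<in> c \<Longrightarrow> le (poset_least le c) y"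
proof -
  have refl: "\<And>x. x \<in> P \<Longrightarrow> le x x"
    using P by (auto simp: finite_poset_def reflp_on_def)
  have trans: "\<And>x y z. x \<in> P \<Longrightarrow> y \<in> P \<Longrightarrow> z \<in> P \<Longrightarrow> le x y \<Longrightarrow> le y z \<Longrightarrow> le x z"
    using P unfolding finite_poset_def transp_on_def by blast
  have "finite c" "c \<noteq> {}" "c \<subseteq> P" "totalp_on c le"
    using c by (auto simp: order_complex_def)
  then have "\<exists>x\<in>c. \<forall>y\<in>c. le x y"
  proof (induction rule: finite_ne_induct)
    case (singleton x)
    then show ?case
      using refl by simp
  next
    case (insert a F)
    then obtain x where x: "x \<in> F" "\<forall>y\<in>F. le x y"
      using totalp_on_subset[of "insert a F" le F] by blast
    have "le a x \<or> le x a"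
      using insert x by (metis insertCI totalp_onD)
    then show ?case
    proof
      assume "le a x"
      then have "\<forall>y\<in>F. le a y"
        using x insert.prems trans by (meson in_mono insert_iff)
      then show ?thesis
        using insert.prems refl by auto
    next
      assume "le x a"
      then show ?thesis
        using x by auto
    qed
  qed
  then obtain x where "x \<in> c" "\<And>y. y \<in> c \<Longrightarrow> le x y"
    by blast
  moreover from this have "poset_least le c = x"
    using c by (intro poset_least_eqI[OF P]) (auto simp: order_complex_def)
  ultimately show "poset_least le c \<in> c" and "y \<in> c \<Longrightarrow> le (poset_least le c) y"
    by auto
qed

lemma poset_least_mono:
  assumes "finite_poset P le" "c \<in> order_complex P le" "d \<in> order_complex P le" "c \<subseteq> d"
  shows "le (poset_least le d) (poset_least le c)"
  using poset_least(2)[OF assms(1,3)] poset_least(1)[OF assms(1,2)] assms(4) by blast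

lemma finite_poset_conversep: "finite_poset P le \<Longrightarrow> finite_poset P le\<inverse>\<inverse>"
  by (auto simp: finite_poset_def)

lemma order_complex_conversep: "order_complex P le\<inverse>\<inverse> = order_complex P le"
  by (auto simp: order_complex_def)

text \<open>This map on chains stands in for the identity: its \<open>sd_map\<close> moves each
  point only within the simplex that carries it.\<close>

lemma antitone_chain_map_poset_least:
  assumes R: "Z2_poset R le \<mu>"
  shows "antitone_chain_map R le \<mu> R le \<mu> (poset_least le)"
proof -
  have P: "finite_poset R le"
    using R by (simp add: Z2_poset_def)
  have "poset_least le (\<mu> ` c) = \<mu> (poset_least le c)" if c: "c \<in> order_complex R le" for c
  proof (rule poset_least_eqI[OF P])
    have "c \<subseteq> R"
      using c by (simp add: order_complex_def)
    then show "\<mu> ` c \<subseteq> R" and "\<mu> (poset_least le c) \<in> \<mu> ` c"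
      using R poset_least(1)[OF P c] by (auto simp: Z2_poset_def)
    show "le (\<mu> (poset_least le c)) y" if "y \<in> \<mu> ` c" for y
      using R that poset_least[OF P c] \<open>c \<subseteq> R\<close> unfolding Z2_poset_def by blast
  qed
  moreover have "poset_least le c \<in> R" if "c \<in> order_complex R le" for c
    using poset_least(1)[OF P that] that by (auto simp: order_complex_def)
  ultimately show ?thesis
    using poset_least_mono[OF P] by (simp add: antitone_chain_map_def)
qed

subsection \<open>Homotopy equivalences from maps on chains\<close>

lemma antitone_chain_map_comp:
  assumes "antitone_chain_map Q le \<nu> R le' \<mu> r" "Z2_poset_map R le' \<mu> S le'' \<kappa> f"
  shows "antitone_chain_map Q le \<nu> S le'' \<kappa> (f \<circ> r)"
proof -
  have "r c \<in> R" "r (\<nu> ` c) = \<mu> (r c)" if "c \<in> order_complex Q le" for c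
    using assms(1) that by (auto simp: antitone_chain_map_def)
  moreover have "le' (r d) (r c)"
    if "c \<in> order_complex Q le" "d \<in> order_complex Q le" "c \<subseteq> d" for c d
    using assms(1) that by (simp add: antitone_chain_map_def)
  moreover have "f x \<in> S" "f (\<mu> x) = \<kappa> (f x)" if "x \<in> R" for x
    using assms(2) that by (auto simp: Z2_poset_map_def)
  moreover have "le'' (f x) (f y)" if "x \<in> R" "y \<in> R" "le' x y" for x y
    using assms(2) that by (simp add: Z2_poset_map_def)
  ultimately show ?thesis
    by (simp add: antitone_chain_map_def)
qed

lemma Z2_map_comp:
  assumes "Z2_map X \<nu> Y \<mu> f" "Z2_map Y \<mu> Z \<kappa> g"
  shows "Z2_map X \<nu> Z \<kappa> (g \<circ> f)"
proof -
  have "f x \<in> topspace Y" if "x \<in> topspace X" for x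
    using assms(1) that continuous_map_funspace by (fastforce simp: Z2_map_def)
  then show ?thesis
    using assms continuous_map_compose[of X Y f Z g] by (simp add: Z2_map_def)
qed

text \<open>The inverse is \<open>sd_map R le' r\<close>. By \<open>rf\<close>, going to
  \<open>R\<close> and back never leaves the carrying simplex. The other composite is joined to the
  identity in three stages: to \<open>sd_map\<close> of \<open>f \<circ> r\<close>, then by
  \<open>fr\<close> to \<open>sd_map\<close> of \<open>poset_least le'\<close>, then to the
  identity.\<close>

lemma Z2_poset_homotopy_equivalenceI:
  assumes Q: "Z2_poset Q le \<nu>" and R: "Z2_poset R le' \<mu>"
    and f: "Z2_poset_map Q le \<nu> R le' \<mu> f"
    and \<nu>: "\<And>x. \<nu> (\<nu> x) = x" and \<mu>: "\<And>x. \<mu> (\<mu> x) = x"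
    and r: "antitone_chain_map R le' \<mu> Q le \<nu> r"
    and rf: "\<And>c. c \<in> order_complex Q le \<Longrightarrow> r (f ` c) \<in> c"
    and fr: "\<And>c. c \<in> order_complex R le' \<Longrightarrow> le' (poset_least le' c) (f (r c))"
  shows "Z2_poset_homotopy_equivalence Q le \<nu> R le' \<mu> f"
proof -
  let ?X = "realization (order_complex Q le)" and ?Y = "realization (order_complex R le')"
  let ?f = "realization_map f" and ?g = "sd_map R le' r"
  have P: "finite_poset R le'" and fin: "finite Q" "finite R"
    using Q R by (auto simp: Z2_poset_def finite_poset_def)
  note least = antitone_chain_map_poset_least[OF R]
  note fr_chain = antitone_chain_map_comp[OF r f]
  have Zf: "Z2_map ?X (realization_map \<nu>) ?Y (realization_map \<mu>) ?f"
    using realization_map_Z2_map[OF Q R f \<nu> \<mu>] .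
  have Zg: "Z2_map ?Y (realization_map \<mu>) ?X (realization_map \<nu>) ?g"
    using sd_map_Z2_map[OF R Q r \<mu> \<nu>] .
  have id: "Z2_map X \<kappa> X \<kappa> id" for X :: "('c \<Rightarrow> real) topology" and \<kappa>
    by (simp add: Z2_map_def)
  have supp_f: "{w. ?f t w \<noteq> 0} \<subseteq> f ` {v. t v \<noteq> 0}" for t
    using realization_map_neq_0D by fastforce
  have "Z2_homotopic ?X (realization_map \<nu>) ?X (realization_map \<nu>) (?g \<circ> ?f) id"
  proof (rule Z2_homotopic_straight_line[OF fin(1) \<nu> Z2_map_comp[OF Zf Zg] id])
    fix t assume "t \<in> topspace ?X"
    then have t: "{v. t v \<noteq> 0} \<subseteq> Q" "totalp_on {v. t v \<noteq> 0} le"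
      by (auto simp: mem_realization_iff[OF fin(1)])
    have "z \<in> {v. t v \<noteq> 0}" if z: "?g (?f t) z \<noteq> 0" for z
    \<comment> \<open>The vertex \<open>z\<close> is \<open>r c\<close> for a chain \<open>c\<close>
      supported in the image of the support of \<open>t\<close>. Writing \<open>c\<close> as the
      image of some \<open>d\<close> inside that support, \<open>rf\<close> places \<open>z\<close>
      in \<open>d\<close>.\<close>
    proof -
      obtain c where c: "c \<in> order_complex R le'" "sd_weight R (?f t) c \<noteq> 0" "r c = z"
        using sd_map_neq_0D[OF z] by blast
      have "c \<subseteq> f ` {v. t v \<noteq> 0}"
        using c sd_weight_neq_0D(1)[OF fin(2), of c "?f t"] supp_f[of t]
        by (auto simp: order_complex_def)
      then obtain d where d: "d \<subseteq> {v. t v \<noteq> 0}" "c = f ` d"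
        by (meson subset_imageE)
      have "d \<in> order_complex Q le"
        using d t c fin(1) finite_subset[of d Q] totalp_on_subset[OF t(2) d(1)]
        by (auto simp: order_complex_def)
      then show ?thesis
        using rf[of d] c d t by auto
    qed
    then have "{v. (?g \<circ> ?f) t v \<noteq> 0} \<union> {v. id t v \<noteq> 0} \<subseteq> {v. t v \<noteq> 0}"
      by auto
    then show "totalp_on ({v. (?g \<circ> ?f) t v \<noteq> 0} \<union> {v. id t v \<noteq> 0}) le"
      using t(2) totalp_on_subset by blast
  qed
  moreover have "Z2_homotopic ?Y (realization_map \<mu>) ?Y (realization_map \<mu>) (?f \<circ> ?g) id"
  proof -
    have "Z2_homotopic ?Y (realization_map \<mu>) ?Y (realization_map \<mu>) (?f \<circ> ?g) (sd_map R le' (f \<circ> r))"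
    proof (rule Z2_homotopic_straight_line[OF fin(2) \<mu> Z2_map_comp[OF Zg Zf]
          sd_map_Z2_map[OF R R fr_chain \<mu> \<mu>]])
      fix t
      \<comment> \<open>Both maps distribute the same weights along \<open>f \<circ> r\<close>.
        Instead of proving them equal, it suffices that both supports lie in the chain of values on
        \<open>S\<close>.\<close>
      define S where "S = {c \<in> order_complex R le'. sd_weight R t c \<noteq> 0}"
      have "le' ((f \<circ> r) d) ((f \<circ> r) c)"
        if "c \<in> order_complex R le'" "d \<in> order_complex R le'" "c \<subseteq> d" for c d
        using fr_chain that by (simp add: antitone_chain_map_def)
      then have "totalp_on ((f \<circ> r) ` S \<union> (f \<circ> r) ` S) le'"
        by (intro sd_weight_totalp_on[OF fin(2) _ _ S_def]) blast+
      moreover have "{v. ?f (?g t) v \<noteq> 0} \<subseteq> (f \<circ> r) ` S"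
        using supp_f[of "?g t"] sd_map_support[of R le' r t] unfolding S_def[symmetric] by fastforce
      moreover have "{v. sd_map R le' (f \<circ> r) t v \<noteq> 0} \<subseteq> (f \<circ> r) ` S"
        using sd_map_support[of R le' "f \<circ> r" t] unfolding S_def[symmetric] .
      ultimately show "totalp_on ({v. (?f \<circ> ?g) t v \<noteq> 0} \<union>
          {v. sd_map R le' (f \<circ> r) t v \<noteq> 0}) le'"
        by (elim totalp_on_subset) auto
    qed
    moreover have "Z2_homotopic ?Y (realization_map \<mu>) ?Y (realization_map \<mu>)
        (sd_map R le' (poset_least le')) (sd_map R le' (f \<circ> r))"
      using fr by (intro sd_map_homotopic_le[OF R R least fr_chain \<mu> \<mu>]) auto
    moreover have "Z2_homotopic ?Y (realization_map \<mu>) ?Y (realization_map \<mu>)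
        (sd_map R le' (poset_least le')) id"
    proof (rule Z2_homotopic_straight_line[OF fin(2) \<mu> sd_map_Z2_map[OF R R least \<mu> \<mu>] id])
      fix t assume "t \<in> topspace ?Y"
      then have t: "totalp_on {v. t v \<noteq> 0} le'"
        by (auto simp: mem_realization_iff[OF fin(2)])
      have "t z \<noteq> 0" if z: "sd_map R le' (poset_least le') t z \<noteq> 0" for z
      \<comment> \<open>A chain of nonzero weight lies inside the support of \<open>t\<close>, and
        so does its least element.\<close>
      proof -
        obtain c where c: "c \<in> order_complex R le'" "sd_weight R t c \<noteq> 0" "poset_least le' c = z"
          using sd_map_neq_0D[OF z] by blast
        then show ?thesis
          using sd_weight_neq_0D(1)[OF fin(2) _ c(2)] poset_least(1)[OF P c(1)]
          by (auto simp: order_complex_def)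
      qed
      then have "{v. sd_map R le' (poset_least le') t v \<noteq> 0} \<union> {v. id t v \<noteq> 0} \<subseteq> {v. t v \<noteq> 0}"
        by auto
      then show "totalp_on ({v. sd_map R le' (poset_least le') t v \<noteq> 0} \<union> {v. id t v \<noteq> 0}) le'"
        using t totalp_on_subset by blast
    qed
    ultimately show ?thesis
      unfolding Z2_homotopic_def using homotopic_with_trans homotopic_with_symD by blast
  qed
  ultimately show ?thesis
    using Q R f Zf Zg unfolding Z2_poset_homotopy_equivalence_def Z2_homotopy_equivalence_def
    by blast
qed

subsection \<open>The extended box poset\<close>

lemma finite_poset_subset: "finite_poset P le \<Longrightarrow> Q \<subseteq> P \<Longrightarrow> finite_poset Q le"
  unfolding finite_poset_def
  by (meson antisymp_on_subset finite_subset reflp_on_subset transp_on_subset)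

lemma finite_poset_prod:
  assumes "finite_poset P le" "finite_poset Q le'"
  shows "finite_poset (P \<times> Q) (rel_prod le le')"
proof -
  have P: "finite P" "reflp_on P le" "transp_on P le" "antisymp_on P le"
    and Q: "finite Q" "reflp_on Q le'" "transp_on Q le'" "antisymp_on Q le'"
    using assms by (auto simp: finite_poset_def)
  have "transp_on (P \<times> Q) (rel_prod le le')"
    by (rule transp_onI)
      (metis mem_Times_iff rel_prod_sel transp_onD[OF P(3)] transp_onD[OF Q(3)])
  moreover have "antisymp_on (P \<times> Q) (rel_prod le le')"
    by (rule antisymp_onI)
      (metis mem_Times_iff prod_eqI rel_prod_sel antisymp_onD[OF P(4)] antisymp_onD[OF Q(4)])
  ultimately show ?thesis
    using P Q by (auto simp: finite_poset_def reflp_on_def)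
qed

lemma finite_poset_hat:
  assumes "finite_poset P le"
  shows "finite_poset (insert None (Some ` P)) (hat_le le)"
proof -
  have P: "finite P" "reflp_on P le" "transp_on P le" "antisymp_on P le"
    using assms by (auto simp: finite_poset_def)
  have "transp_on (insert None (Some ` P)) (hat_le le)"
  proof (rule transp_onI)
    fix x y z
    assume "x \<in> insert None (Some ` P)" "y \<in> insert None (Some ` P)" "z \<in> insert None (Some ` P)"
      and "hat_le le x y" "hat_le le y z"
    then show "hat_le le x z"
      by (cases x; cases y; cases z) (simp_all add: image_iff, meson transp_onD[OF P(3)])
  qed
  moreover have "antisymp_on (insert None (Some ` P)) (hat_le le)"
  proof (rule antisymp_onI)
    fix x y
    assume "x \<in> insert None (Some ` P)" "y \<in> insert None (Some ` P)"
      and "hat_le le x y" "hat_le le y x"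
    then show "x = y"
      by (cases x; cases y) (simp_all add: image_iff, meson antisymp_onD[OF P(4)])
  qed
  ultimately show ?thesis
    using P by (auto simp: finite_poset_def reflp_on_def)
qed

section \<open>Box posets with the swap involution and the inclusion between them\<close>

lemma Z2_poset_box:
  assumes "weakly_involutive_poset P le C"
  shows "Z2_poset (box_poset P le C) (box_le le) prod.swap"
proof -
  have "finite_poset (P \<times> P) (box_le le)"
    using assms by (simp add: box_le_def finite_poset_prod weakly_involutive_poset_def)
  then have "finite_poset (box_poset P le C) (box_le le)"
    by (rule finite_poset_subset) (auto simp: box_poset_def)
  then show ?thesis
    by (auto simp: Z2_poset_def box_poset_def box_le_def)
qed

lemma mem_ext_box_poset [simp]:
  "(None, None) \<notin> ext_box_poset P le C"
  "(Some x, None) \<in> ext_box_poset P le C \<longleftrightarrow> x \<in> P"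
  "(None, Some y) \<in> ext_box_poset P le C \<longleftrightarrow> y \<in> P"
  "(Some x, Some y) \<in> ext_box_poset P le C \<longleftrightarrow> (x, y) \<in> box_poset P le C"
  by (auto simp: ext_box_poset_def box_incl_def)

lemma Z2_poset_ext_box:
  assumes "weakly_involutive_poset P le C"
  shows "Z2_poset (ext_box_poset P le C) (ext_box_le le) prod.swap"
proof -
  let ?H = "insert None (Some ` P)"
  have "finite_poset (?H \<times> ?H) (ext_box_le le)"
    using assms unfolding ext_box_le_def weakly_involutive_poset_def
    by (intro finite_poset_prod finite_poset_hat) simp_all
  then have "finite_poset (ext_box_poset P le C) (ext_box_le le)"
    by (rule finite_poset_subset) (auto simp: ext_box_poset_def box_poset_def box_incl_def)
  moreover have "prod.swap x \<in> ext_box_poset P le C" if "x \<in> ext_box_poset P le C" for x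
    using that by (force simp: ext_box_poset_def box_poset_def box_incl_def)
  ultimately show ?thesis
    by (auto simp: Z2_poset_def ext_box_le_def rel_prod_sel)
qed

lemma Z2_poset_map_box_incl:
  "Z2_poset_map (box_poset P le C) (box_le le) prod.swap
     (ext_box_poset P le C) (ext_box_le le) prod.swap box_incl"
  by (auto simp: Z2_poset_map_def box_incl_def ext_box_poset_def box_le_def ext_box_le_def)

text \<open>For empty \<open>A\<close> the default uses the greatest element of \<open>B\<close>,
  not the least: it rises as \<open>B\<close> grows, so its image under \<open>C\<close> falls, as
  antitonicity requires.\<close>

definition chain_coord :: "('a \<Rightarrow> 'a \<Rightarrow> bool) \<Rightarrow> ('a \<Rightarrow> 'a) \<Rightarrow> 'a set \<Rightarrow> 'a set \<Rightarrow> 'a" where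
  "chain_coord le C A B = (if A = {} then C (poset_least le\<inverse>\<inverse> B) else poset_least le A)"

definition box_retract ::
    "('a \<Rightarrow> 'a \<Rightarrow> bool) \<Rightarrow> ('a \<Rightarrow> 'a) \<Rightarrow> ('a option \<times> 'a option) set \<Rightarrow> 'a \<times> 'a" where
  "box_retract le C c =
     (let A = {x. Some x \<in> fst ` c}; B = {y. Some y \<in> snd ` c}
      in (chain_coord le C A B, chain_coord le C B A))"

section \<open>The retraction on chains and its two comparison properties\<close>

context
  fixes P :: "'a set" and le :: "'a \<Rightarrow> 'a \<Rightarrow> bool" and C :: "'a \<Rightarrow> 'a"
  assumes wip: "weakly_involutive_poset P le C"
begin

lemma finite_poset_P: "finite_poset P le"
  and C_closed: "x \<in> P \<Longrightarrow> C x \<in> P"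
  and C_antitone: "x \<in> P \<Longrightarrow> y \<in> P \<Longrightarrow> le x y \<Longrightarrow> le (C y) (C x)"
  and le_CC: "x \<in> P \<Longrightarrow> le x (C (C x))"
  using wip by (auto simp: weakly_involutive_poset_def)

lemma P_trans: "x \<in> P \<Longrightarrow> y \<in> P \<Longrightarrow> z \<in> P \<Longrightarrow> le x y \<Longrightarrow> le y z \<Longrightarrow> le x z"
  using finite_poset_P unfolding finite_poset_def transp_on_def by blast

lemma poset_greatest:
  assumes "c \<in> order_complex P le"
  shows "poset_least le\<inverse>\<inverse> c \<in> c" and "y \<in> c \<Longrightarrow> le y (poset_least le\<inverse>\<inverse> c)"
  using assms poset_least[OF finite_poset_conversep[OF finite_poset_P], of c]
  by (auto simp: order_complex_conversep)

text \<open>This records what is needed of a chain in the extended box poset once it is split into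
  its proper first and second coordinates. The condition is symmetric, so each fact about
  \<open>chain_coord\<close> is proved for one coordinate only.\<close>

definition compatible_chains :: "'a set \<Rightarrow> 'a set \<Rightarrow> bool" where
  "compatible_chains A B \<longleftrightarrow>
     A \<in> insert {} (order_complex P le) \<and> B \<in> insert {} (order_complex P le) \<and>
     A \<union> B \<noteq> {} \<and> (\<forall>x\<in>A. \<forall>y\<in>B. le x (C y) \<and> le y (C x))"

lemma chain_coord_closed:
  assumes "compatible_chains A B"
  shows "chain_coord le C A B \<in> P"
proof -
  have sub: "D \<subseteq> P" if "D \<in> order_complex P le" for D
    using that by (simp add: order_complex_def)
  show ?thesis
  proof (cases "A = {}")
    case True
    then have "B \<in> order_complex P le"
      using assms by (auto simp: compatible_chains_def)
    then show ?thesis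
      using True poset_greatest(1)[of B] sub[of B] by (auto simp: chain_coord_def intro: C_closed)
  next
    case False
    then have "A \<in> order_complex P le"
      using assms by (auto simp: compatible_chains_def)
    then show ?thesis
      using False poset_least(1)[OF finite_poset_P, of A] sub[of A] by (auto simp: chain_coord_def)
  qed
qed

text \<open>If both sets are nonempty, compatibility applies to their least elements. If one is
  empty, let \<open>m\<close> and \<open>g\<close> be the least and greatest elements of the other:
  then \<open>C g\<close> is below \<open>C m\<close>, and \<open>m\<close> is below
  \<open>g\<close>, hence below \<open>C (C g)\<close>.\<close>

lemma chain_coord_le_C:
  assumes "compatible_chains A B"
  shows "le (chain_coord le C A B) (C (chain_coord le C B A))"
proof (cases "A = {} \<or> B = {}")
  case False
  then show ?thesis
    using assms poset_least(1)[OF finite_poset_P]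
    by (auto simp: compatible_chains_def chain_coord_def)
next
  case True
  have swap: "le (C (poset_least le\<inverse>\<inverse> B)) (C (poset_least le B))"
    "le (poset_least le B) (C (C (poset_least le\<inverse>\<inverse> B)))" if B: "B \<in> order_complex P le" for B
  proof -
    have mem: "poset_least le B \<in> P" "poset_least le\<inverse>\<inverse> B \<in> P"
      and le: "le (poset_least le B) (poset_least le\<inverse>\<inverse> B)"
      using poset_greatest[OF B] poset_least[OF finite_poset_P B] B
      by (auto simp: order_complex_def)
    then show "le (C (poset_least le\<inverse>\<inverse> B)) (C (poset_least le B))"
      "le (poset_least le B) (C (C (poset_least le\<inverse>\<inverse> B)))"
      using C_antitone[OF mem le]
        P_trans[OF mem C_closed[OF C_closed[OF mem(2)]] le le_CC[OF mem(2)]] by auto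
  qed
  with True assms show ?thesis
    by (auto simp: compatible_chains_def chain_coord_def)
qed

text \<open>When \<open>A\<close> is nonempty or \<open>A'\<close> is empty, a least element drops
  or a greatest one rises under \<open>C\<close>. The critical case is a coordinate that first
  appears in \<open>A'\<close>: the default must bound it from above.\<close>

lemma chain_coord_antitone:
  assumes AB: "compatible_chains A B" and AB': "compatible_chains A' B'"
    and sub: "A \<subseteq> A'" "B \<subseteq> B'"
  shows "le (chain_coord le C A' B') (chain_coord le C A B)"
proof (cases "A = {}")
  case False
  then show ?thesis
    using AB AB' sub poset_least_mono[OF finite_poset_P, of A A']
    by (auto simp: compatible_chains_def chain_coord_def)
next
  case True
  then have B: "B \<in> order_complex P le" and B': "B' \<in> order_complex P le"
    using AB AB' sub by (auto simp: compatible_chains_def)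
  have g: "poset_least le\<inverse>\<inverse> B \<in> B" "poset_least le\<inverse>\<inverse> B \<in> P" "poset_least le\<inverse>\<inverse> B' \<in> P"
    "le (poset_least le\<inverse>\<inverse> B) (poset_least le\<inverse>\<inverse> B')"
    using poset_greatest[OF B] poset_greatest[OF B'] B B' sub by (auto simp: order_complex_def)
  show ?thesis
  proof (cases "A' = {}")
    case A': True
    then show ?thesis
      using True g C_antitone by (simp add: chain_coord_def)
  next
    case False
    \<comment> \<open>The greatest element of \<open>B\<close> also lies in \<open>B'\<close>, so
      compatibility of \<open>A'\<close> with \<open>B'\<close> puts this least element below the
      default \<open>C (poset_least le\<inverse>\<inverse> B)\<close>.\<close>
    then have "poset_least le A' \<in> A'"
      using AB' poset_least(1)[OF finite_poset_P] by (auto simp: compatible_chains_def)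
    then show ?thesis
      using True False AB' g sub by (auto simp: compatible_chains_def chain_coord_def)
  qed
qed

text \<open>Even when \<open>x\<close> and \<open>y\<close> come from different entries of the
  chain, those entries are comparable. The larger one has two proper coordinates, hence lies in the
  box poset, and its inequalities pass down to \<open>x\<close> and \<open>y\<close>.\<close>

lemma ext_box_chain_compatible:
  assumes c: "c \<in> order_complex (ext_box_poset P le C) (ext_box_le le)"
  shows "compatible_chains {x. Some x \<in> fst ` c} {y. Some y \<in> snd ` c}"
proof -
  define A where "A = {x. Some x \<in> fst ` c}"
  define B where "B = {y. Some y \<in> snd ` c}"
  have sub: "c \<subseteq> ext_box_poset P le C" and "finite c" "c \<noteq> {}" and tot: "totalp_on c (ext_box_le le)"
    using c by (auto simp: order_complex_def)
  have box: "x \<in> P" "y \<in> P" "le x (C y)" "le y (C x)" if "(Some x, Some y) \<in> c" for x y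
    using that sub by (auto simp: box_poset_def dest: subsetD)
  have fst_P: "x \<in> P" if "(Some x, b) \<in> c" for x b
    using that sub box by (cases b) (auto dest: subsetD)
  have snd_P: "y \<in> P" if "(a, Some y) \<in> c" for a y
    using that sub box by (cases a) (auto dest: subsetD)
  have cmp: "u = v \<or> ext_box_le le u v \<or> ext_box_le le v u" if "u \<in> c" "v \<in> c" for u v
    using tot that by (metis totalp_onD)
  have compat: "le x (C y) \<and> le y (C x)" if x: "(Some x, b) \<in> c" and y: "(a, Some y) \<in> c" for x y a b
    using cmp[OF x y]
  proof (elim disjE)
    assume "(Some x, b) = (a, Some y)"
    then show ?thesis
      using x box by auto
  next
    \<comment> \<open>Nothing above \<open>Some x\<close> is \<open>None\<close>, so
      \<open>a\<close> is some \<open>x'\<close> above \<open>x\<close>. Then \<open>x\<close> is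
      below \<open>x'\<close>, which is below \<open>C y\<close>, and \<open>y\<close> is below
      \<open>C x'\<close>, which is below \<open>C x\<close>.\<close>
    assume "ext_box_le le (Some x, b) (a, Some y)"
    then obtain x' where x': "a = Some x'" "le x x'"
      by (cases a) (auto simp: ext_box_le_def)
    have b: "x' \<in> P" "y \<in> P" "le x' (C y)" "le y (C x')"
      using box[of x' y] y x' by auto
    show ?thesis
      using P_trans[OF fst_P[OF x] b(1) C_closed[OF b(2)] x'(2) b(3)]
        P_trans[OF b(2) C_closed[OF b(1)] C_closed[OF fst_P[OF x]] b(4)
          C_antitone[OF fst_P[OF x] b(1) x'(2)]] by simp
  next
    assume "ext_box_le le (a, Some y) (Some x, b)"
    then obtain y' where y': "b = Some y'" "le y y'"
      by (cases b) (auto simp: ext_box_le_def)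
    have b: "y' \<in> P" "x \<in> P" "le y' (C x)" "le x (C y')"
      using box[of x y'] x y' by auto
    show ?thesis
      using P_trans[OF snd_P[OF y] b(1) C_closed[OF b(2)] y'(2) b(3)]
        P_trans[OF b(2) C_closed[OF b(1)] C_closed[OF snd_P[OF y]] b(4)
          C_antitone[OF snd_P[OF y] b(1) y'(2)]] by simp
  qed
  have "totalp_on A le" "totalp_on B le"
    using cmp by (fastforce simp: A_def B_def totalp_on_def ext_box_le_def)+
  moreover have "finite A" "finite B"
    using \<open>finite c\<close> finite_vimageI[of "fst ` c" Some] finite_vimageI[of "snd ` c" Some]
    by (auto simp: A_def B_def vimage_def)
  \<comment> \<open>The pair \<open>(None, None)\<close> is excluded from the extended box poset, so
    any entry of \<open>c\<close> has a proper coordinate.\<close>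
  moreover have "A \<union> B \<noteq> {}"
  proof -
    obtain a b where ab: "(a, b) \<in> c"
      using \<open>c \<noteq> {}\<close> by auto
    then have "a \<noteq> None \<or> b \<noteq> None"
      using ab sub by (cases a; cases b) auto
    with ab show ?thesis
      by (force simp: A_def B_def)
  qed
  moreover have "A \<subseteq> P" "B \<subseteq> P"
    using fst_P snd_P by (auto simp: A_def B_def)
  moreover have "\<forall>x\<in>A. \<forall>y\<in>B. le x (C y) \<and> le y (C x)"
    using compat by (auto simp: A_def B_def)
  ultimately show ?thesis
    unfolding compatible_chains_def A_def[symmetric] B_def[symmetric]
    by (simp add: order_complex_def)
qed

lemma compatible_chains_commute: "compatible_chains A B \<Longrightarrow> compatible_chains B A"
  by (auto simp: compatible_chains_def)

lemma antitone_chain_map_box_retract: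
  "antitone_chain_map (ext_box_poset P le C) (ext_box_le le) prod.swap
     (box_poset P le C) (box_le le) prod.swap (box_retract le C)"
proof -
  let ?K = "order_complex (ext_box_poset P le C) (ext_box_le le)"
  note AB = ext_box_chain_compatible
  note BA = compatible_chains_commute[OF AB]
  have "box_retract le C c \<in> box_poset P le C" if "c \<in> ?K" for c
    using chain_coord_closed[OF AB[OF that]] chain_coord_closed[OF BA[OF that]]
      chain_coord_le_C[OF AB[OF that]] chain_coord_le_C[OF BA[OF that]]
    by (simp add: box_retract_def box_poset_def)
  moreover have "box_le le (box_retract le C d) (box_retract le C c)"
    if c: "c \<in> ?K" and d: "d \<in> ?K" and "c \<subseteq> d" for c d
  proof -
    have "{x. Some x \<in> fst ` c} \<subseteq> {x. Some x \<in> fst ` d}" "{y. Some y \<in> snd ` c} \<subseteq> {y. Some y \<in> snd ` d}"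
      using \<open>c \<subseteq> d\<close> by auto
    then show ?thesis
      using chain_coord_antitone[OF AB[OF c] AB[OF d]] chain_coord_antitone[OF BA[OF c] BA[OF d]]
      by (simp add: box_retract_def box_le_def)
  qed
  moreover have "box_retract le C (prod.swap ` c) = prod.swap (box_retract le C c)" for c
    by (simp add: box_retract_def image_image)
  ultimately show ?thesis
    by (auto simp: antitone_chain_map_def)
qed

lemma box_retract_incl:
  assumes c: "c \<in> order_complex (box_poset P le C) (box_le le)"
  shows "box_retract le C (box_incl ` c) \<in> c"
proof -
  have B: "finite_poset (box_poset P le C) (box_le le)"
    using Z2_poset_box[OF wip] by (simp add: Z2_poset_def)
  obtain x y where xy: "(x, y) \<in> c" and least: "\<And>a b. (a, b) \<in> c \<Longrightarrow> le x a \<and> le y b"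
    using poset_least[OF B c] by (cases "poset_least (box_le le) c") (force simp: box_le_def)
  have A: "{x. Some x \<in> fst ` box_incl ` c} = fst ` c" "{y. Some y \<in> snd ` box_incl ` c} = snd ` c"
    by (force simp: box_incl_def)+
  have "c \<subseteq> P \<times> P"
    using c by (auto simp: order_complex_def box_poset_def)
  then have "poset_least le (fst ` c) = x" "poset_least le (snd ` c) = y"
    using xy least by (intro poset_least_eqI[OF finite_poset_P]; force)+
  moreover have "c \<noteq> {}"
    using xy by auto
  ultimately have "box_retract le C (box_incl ` c) = (x, y)"
    unfolding box_retract_def A by (simp add: chain_coord_def)
  with xy show ?thesis
    by simp
qed

text \<open>Compare coordinatewise. A \<open>None\<close> in the least pair lies below anything,
  including a default value; a proper coordinate shows that its place is occupied, and it lies below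
  every entry there, in particular below their minimum.\<close>

lemma poset_least_le_box_retract:
  assumes c: "c \<in> order_complex (ext_box_poset P le C) (ext_box_le le)"
  shows "ext_box_le le (poset_least (ext_box_le le) c) (box_incl (box_retract le C c))"
proof -
  have E: "finite_poset (ext_box_poset P le C) (ext_box_le le)"
    using Z2_poset_ext_box[OF wip] by (simp add: Z2_poset_def)
  obtain a b where ab: "poset_least (ext_box_le le) c = (a, b)"
    by (cases "poset_least (ext_box_le le) c")
  have mem: "(a, b) \<in> c" and least: "\<And>u v. (u, v) \<in> c \<Longrightarrow> hat_le le a u \<and> hat_le le b v"
    using poset_least[OF E c, unfolded ab] by (auto simp: ext_box_le_def)
  have compat: "compatible_chains {x. Some x \<in> fst ` c} {y. Some y \<in> snd ` c}"
    using ext_box_chain_compatible[OF c] .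
  have "hat_le le a (Some (chain_coord le C {x. Some x \<in> fst ` c} {y. Some y \<in> snd ` c}))"
  proof (cases a)
    case (Some x)
    then have "{x. Some x \<in> fst ` c} \<noteq> {}"
      using mem by force
    moreover from this have "poset_least le {x. Some x \<in> fst ` c} \<in> {x. Some x \<in> fst ` c}"
      using compat poset_least(1)[OF finite_poset_P] by (auto simp: compatible_chains_def)
    ultimately show ?thesis
      using least by (auto simp: chain_coord_def)
  qed simp
  moreover have "hat_le le b (Some (chain_coord le C {y. Some y \<in> snd ` c} {x. Some x \<in> fst ` c}))"
  proof (cases b)
    case (Some y)
    then have "{y. Some y \<in> snd ` c} \<noteq> {}"
      using mem by force
    moreover from this have "poset_least le {y. Some y \<in> snd ` c} \<in> {y. Some y \<in> snd ` c}"
      using compat poset_least(1)[OF finite_poset_P] by (auto simp: compatible_chains_def)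
    ultimately show ?thesis
      using least by (auto simp: chain_coord_def)
  qed simp
  ultimately show ?thesis
    unfolding ab by (simp add: ext_box_le_def box_incl_def box_retract_def)
qed

end

theorem theorem4p2:
  fixes P :: "'a set" and le :: "'a \<Rightarrow> 'a \<Rightarrow> bool" and C :: "'a \<Rightarrow> 'a"
  assumes "weakly_involutive_poset P le C"
  shows "Z2_poset_homotopy_equivalence
           (box_poset P le C) (box_le le) prod.swap
           (ext_box_poset P le C) (ext_box_le le) prod.swap
           box_incl"
  by (rule Z2_poset_homotopy_equivalenceI[OF Z2_poset_box[OF assms] Z2_poset_ext_box[OF assms]
        Z2_poset_map_box_incl swap_swap swap_swap antitone_chain_map_box_retract[OF assms]
        box_retract_incl[OF assms] poset_least_le_box_retract[OF assms]])

end
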